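(* Let $G$ be a finite connected graph with chromatic number $\chi(G)=3$, and suppose $G$ is not isomorphic to the cycle $C_7$ on seven vertices. Then $G$ admits a proper $3$-coloring $c:V(G)\to\{1,2,3\}$ such that every vertex $x$ of $G$ is the first vertex of a colorful path, i.e. for every $x\in V(G)$ there is a path $x=x_1x_2x_3$ in $G$ on three distinct vertices with $c(x_1),c(x_2),c(x_3)$ pairwise distinct.
   Context: A proper $k$-coloring of a graph $G$ is a map $c:V(G)\to\{1,\dots,k\}$ with $c(u)\neq c(v)$ whenever $u,v$ are adjacent. Given a $\chi(G)$-coloring, a colorful path is a path on $\chi(G)$ distinct vertices whose vertices receive pairwise distinct colors (hence every color appears exactly once on it). *)

theory Defs
  imports Main
begin

definition simple_graph :: "'a set \<Rightarrow> ('a \<Rightarrow> 'a \<Rightarrow> bool) \<Rightarrow> bool" where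
  "simple_graph V E \<longleftrightarrow> finite V \<and>
     (\<forall>u v. E u v \<longrightarrow> u \<in> V \<and> v \<in> V \<and> u \<noteq> v \<and> E v u)"

definition graph_connected :: "'a set \<Rightarrow> ('a \<Rightarrow> 'a \<Rightarrow> bool) \<Rightarrow> bool" where
  "graph_connected V E \<longleftrightarrow> V \<noteq> {} \<and> (\<forall>u\<in>V. \<forall>v\<in>V. E\<^sup>*\<^sup>* u v)"

definition proper_coloring :: "'a set \<Rightarrow> ('a \<Rightarrow> 'a \<Rightarrow> bool) \<Rightarrow> nat \<Rightarrow> ('a \<Rightarrow> nat) \<Rightarrow> bool" where
  "proper_coloring V E k c \<longleftrightarrow> c ` V \<subseteq> {1..k} \<and> (\<forall>u\<in>V. \<forall>v\<in>V. E u v \<longrightarrow> c u \<noteq> c v)"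

definition chromatic_number :: "'a set \<Rightarrow> ('a \<Rightarrow> 'a \<Rightarrow> bool) \<Rightarrow> nat" where
  "chromatic_number V E = (LEAST k. \<exists>c. proper_coloring V E k c)"

definition is_path :: "'a set \<Rightarrow> ('a \<Rightarrow> 'a \<Rightarrow> bool) \<Rightarrow> 'a list \<Rightarrow> bool" where
  "is_path V E p \<longleftrightarrow> p \<noteq> [] \<and> set p \<subseteq> V \<and> distinct p \<and>
     (\<forall>i. Suc i < length p \<longrightarrow> E (p ! i) (p ! Suc i))"

definition colorful_path :: "'a set \<Rightarrow> ('a \<Rightarrow> 'a \<Rightarrow> bool) \<Rightarrow> ('a \<Rightarrow> nat) \<Rightarrow> 'a list \<Rightarrow> bool" where
  "colorful_path V E c p \<longleftrightarrow> is_path V E p \<and> length p = chromatic_number V E \<and> distinct (map c p)"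

definition cycle_graph :: "nat \<Rightarrow> nat \<Rightarrow> nat \<Rightarrow> bool" where
  "cycle_graph n i j \<longleftrightarrow> i < n \<and> j < n \<and> (j = (i + 1) mod n \<or> i = (j + 1) mod n) \<and> i \<noteq> j"

definition graph_iso :: "'a set \<Rightarrow> ('a \<Rightarrow> 'a \<Rightarrow> bool) \<Rightarrow> 'b set \<Rightarrow> ('b \<Rightarrow> 'b \<Rightarrow> bool) \<Rightarrow> bool" where
  "graph_iso V1 E1 V2 E2 \<longleftrightarrow> (\<exists>f. bij_betw f V1 V2 \<and>
      (\<forall>u\<in>V1. \<forall>v\<in>V1. E1 u v \<longleftrightarrow> E2 (f u) (f v)))"

end

(*
  Colour with residues mod 3 and orient each edge from colour a + 1 to colour a.  In a proper
  colouring a vertex starts a colourful path unless all vertices two steps away share its colour;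
  call such a vertex stuck, and suppose that every proper 3-colouring has a stuck vertex.
  Shifting the colours of a set that no edge leaves makes every vertex reach a prescribed set.
  A directed cycle would then leave nothing stuck, so no colouring has one, and for a root r the
  longest directed walks define levels that determine the colours.  Take such a levelling of
  maximal height.  A stuck vertex b has level 1, its neighbours other than r are sources, and
  reversing b and these sources turns b into the root of another levelling.  By maximality all top
  vertices are adjacent to b.  Recolouring one vertex x just below the top together with the top
  vertices above it unsticks everything unless every neighbour of b other than r is adjacent to x.
  Comparing three consecutive rotations, b has exactly two neighbours.  The stuck vertices are
  closed under adjacency, so the graph is a cycle of length height + 2 = 1 (mod 3); beyond 7
  vertices such a cycle has a colouring with nothing stuck.
*)

theory Submission
  imports Defs
begin

section \<open>Arithmetic modulo three\<close>

lemma mod3_add_left_cancel: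
  assumes "(a + b) mod 3 = (a + c) mod (3 :: nat)"
  shows "b mod 3 = c mod 3"
proof -
  have "(2 * a + (a + b)) mod 3 = (2 * a + (a + c)) mod 3"
    using assms by (metis mod_add_right_eq)
  then have "(b + 3 * a) mod 3 = (c + 3 * a) mod 3" by (simp add: algebra_simps)
  then show ?thesis by simp
qed

lemma mod3_Suc_eq: "Suc a mod 3 = Suc b mod 3 \<longleftrightarrow> a mod 3 = b mod 3"
  using mod3_add_left_cancel[of 1 a b] by (auto simp: mod_Suc)

lemma mod3_Suc_neq: "Suc a mod 3 \<noteq> a mod 3" and mod3_neq_Suc: "a mod 3 \<noteq> Suc a mod 3"
  by (auto simp: mod_Suc)

lemma mod3_Suc2_neq: "Suc (Suc a) mod 3 \<noteq> a mod 3" and mod3_neq_Suc2: "a mod 3 \<noteq> Suc (Suc a) mod 3"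
  by (auto simp: mod_Suc)

lemma mod3_Suc_cong:
  "a mod 3 = Suc b mod 3 \<Longrightarrow> Suc (Suc b) mod 3 = Suc a mod 3"
  using mod3_Suc_eq by metis

lemma mod3_asym:
  assumes "a mod 3 = (b + 1) mod 3"
  shows "b mod 3 \<noteq> (a + 1) mod (3 :: nat)"
  using assms mod3_Suc_cong mod3_neq_Suc2 by (metis Suc_eq_plus1)

lemma mod3_trichotomy:
  "a mod 3 = b mod 3 \<or> a mod 3 = (b + 1) mod 3 \<or> b mod 3 = (a + 1) mod (3 :: nat)"
proof -
  have "a mod 3 < 3" "b mod 3 < 3" by simp_all
  then have "a mod 3 = 0 \<or> a mod 3 = 1 \<or> a mod 3 = 2" "b mod 3 = 0 \<or> b mod 3 = 1 \<or> b mod 3 = 2"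
    by linarith+
  then show ?thesis by (auto simp: mod_Suc)
qed

text \<open>The possible gaps are 1, 4, 7, and so on, and only the first fits between 0 and
  3.\<close>

lemma mod3_small:
  fixes a b :: nat
  assumes "a \<le> 3" "b < a \<and> a mod 3 = (b + 1) mod 3"
  shows "a = Suc b"
proof -
  have "a = 1 \<or> a = 2 \<or> a = 3" "b = 0 \<or> b = 1 \<or> b = 2" using assms by linarith+
  then show ?thesis using assms(2) by auto
qed

lemma relpowp_shorten:
  fixes R :: "'a \<Rightarrow> 'a \<Rightarrow> bool"
  assumes "(R ^^ n) x y" "m \<le> n"
  shows "\<exists>z. (R ^^ m) x z"
proof -
  have "(R ^^ m OO R ^^ (n - m)) x y" using assms by (simp add: relpowp_add[symmetric])
  then show ?thesis by blast
qed

section \<open>Graphs in which every colouring has a stuck vertex\<close>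

text \<open>The situation of a counterexample, eventually shown to force the seven-cycle. Colours
  are residues of arbitrary naturals, so shifts and levels are colourings without renormalisation;
  \<open>colourable\<close> and \<open>not_bipartite\<close> encode chromatic number three.\<close>

locale stubborn_graph =
  fixes V :: "'a set" and E :: "'a \<Rightarrow> 'a \<Rightarrow> bool"
  assumes finite_V: "finite V"
    and E_in: "E u v \<Longrightarrow> u \<in> V \<and> v \<in> V"
    and E_sym: "E u v \<Longrightarrow> E v u"
    and nonempty: "V \<noteq> {}"
    and connected: "u \<in> V \<Longrightarrow> v \<in> V \<Longrightarrow> E\<^sup>*\<^sup>* u v"
    and colourable: "\<exists>f :: 'a \<Rightarrow> nat. \<forall>u v. E u v \<longrightarrow> f u mod 3 \<noteq> f v mod 3"
    and not_bipartite: "\<not> (\<exists>h :: 'a \<Rightarrow> bool. \<forall>u v. E u v \<longrightarrow> h u \<noteq> h v)"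
    and stubborn: "\<forall>u v. E u v \<longrightarrow> f u mod 3 \<noteq> (f v :: nat) mod 3 \<Longrightarrow>
      \<exists>x\<in>V. \<forall>y z. E x y \<longrightarrow> E y z \<longrightarrow> f z mod 3 = f x mod 3"
begin

definition proper3 :: "('a \<Rightarrow> nat) \<Rightarrow> bool" where
  "proper3 f \<longleftrightarrow> (\<forall>u v. E u v \<longrightarrow> f u mod 3 \<noteq> f v mod 3)"

definition arc :: "('a \<Rightarrow> nat) \<Rightarrow> 'a \<Rightarrow> 'a \<Rightarrow> bool" where
  "arc f u v \<longleftrightarrow> E u v \<and> f u mod 3 = (f v + 1) mod 3"

definition stuck :: "('a \<Rightarrow> nat) \<Rightarrow> 'a \<Rightarrow> bool" where
  "stuck f x \<longleftrightarrow> x \<in> V \<and> (\<forall>y z. E x y \<longrightarrow> E y z \<longrightarrow> f z mod 3 = f x mod 3)"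

lemma ex_stuck: "proper3 f \<Longrightarrow> \<exists>x. stuck f x"
  using stubborn unfolding proper3_def stuck_def by blast

lemma nbr_closed_eq_V:
  assumes "X \<subseteq> V" "X \<noteq> {}" and cl: "\<And>u v. u \<in> X \<Longrightarrow> E u v \<Longrightarrow> v \<in> X"
  shows "X = V"
proof -
  obtain a where a: "a \<in> X" using assms(2) by blast
  have "v \<in> X" if "v \<in> V" for v
  proof -
    have "E\<^sup>*\<^sup>* a v" using connected a assms(1) that by blast
    then show ?thesis by (induction) (use a cl in auto)
  qed
  then show ?thesis using assms(1) by blast
qed

section \<open>Shifting colours and excluding directed cycles\<close>

text \<open>If no arc enters \<open>T\<close>, then every edge between \<open>T\<close> and its
  complement points out of \<open>T\<close>. Adding 2, that is subtracting 1, outside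
  \<open>T\<close> reverses exactly these edges.\<close>

lemma push:
  assumes f: "proper3 f" and T: "T \<subseteq> V" "T \<noteq> {}" "T \<noteq> V"
  shows "\<exists>f'. proper3 f' \<and> (\<forall>t\<in>T. f' t = f t) \<and> (\<exists>u\<in>V - T. \<exists>t\<in>T. arc f' u t)"
proof (cases "\<exists>u\<in>V - T. \<exists>t\<in>T. arc f u t")
  case True
  then show ?thesis using f by blast
next
  case False
  define f' where "f' v = (if v \<in> T then f v else f v + 2)" for v
  obtain t u where tu: "t \<in> T" "E t u" "u \<notin> T"
    using nbr_closed_eq_V[OF T(1,2)] T(3) by blast
  have cross: "f v mod 3 = (f w + 1) mod 3" if "E v w" "v \<in> T" "w \<notin> T" for v w
  proof -
    have "\<not> arc f w v" using False that E_in by blast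
    then have "f w mod 3 \<noteq> (f v + 1) mod 3" using that E_sym by (auto simp: arc_def)
    moreover have "f w mod 3 \<noteq> f v mod 3" using f that unfolding proper3_def by metis
    ultimately show ?thesis using mod3_trichotomy by blast
  qed
  have "proper3 f'"
    unfolding proper3_def
  proof (intro allI impI)
    fix v w assume e: "E v w"
    have p: "f v mod 3 \<noteq> f w mod 3" using e f unfolding proper3_def by blast
    consider "v \<in> T \<longleftrightarrow> w \<in> T" | "v \<in> T" "w \<notin> T" | "v \<notin> T" "w \<in> T" by blast
    then show "f' v mod 3 \<noteq> f' w mod 3"
    proof cases
      case 1
      then have "f' v = f v \<and> f' w = f w \<or> f' v = f v + 2 \<and> f' w = f w + 2"
        unfolding f'_def by simp
      then show ?thesis using p by (auto simp: mod3_Suc_eq)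
    next
      case 2
      then show ?thesis using cross[OF e 2] 2 by (simp add: f'_def mod3_Suc_eq mod3_neq_Suc)
    next
      case 3
      then show ?thesis using cross[OF E_sym[OF e] 3(2,1)] 3 by (simp add: f'_def mod3_Suc_eq mod3_Suc_neq)
    qed
  qed
  moreover have "arc f' u t"
  proof -
    have "f t mod 3 = Suc (f u) mod 3" using cross[OF tu(2,1,3)] by simp
    then have "Suc (Suc (f u)) mod 3 = Suc (f t) mod 3" by (rule mod3_Suc_cong)
    then show ?thesis using tu E_sym unfolding arc_def f'_def by simp
  qed
  moreover have "u \<in> V" using tu E_in by blast
  moreover have "\<forall>t\<in>T. f' t = f t" unfolding f'_def by simp
  ultimately show ?thesis using tu by blast
qed

text \<open>Iterates \<open>push\<close>, each time absorbing the tail of the new arc. Colours on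
  the enlarged set are frozen from then on, so arcs already obtained survive.\<close>

lemma extend:
  assumes "proper3 f" "T \<subseteq> V" "T \<noteq> {}"
  shows "\<exists>f'. proper3 f' \<and> (\<forall>t\<in>T. f' t = f t) \<and> (\<forall>u\<in>V. \<exists>t\<in>T. (arc f')\<^sup>*\<^sup>* u t)"
  using assms
proof (induction "card (V - T)" arbitrary: f T rule: less_induct)
  case less
  show ?case
  proof (cases "T = V")
    case True
    then show ?thesis using less.prems by blast
  next
    case False
    obtain f' u t where f': "proper3 f'" "\<forall>t\<in>T. f' t = f t" "u \<in> V - T" "t \<in> T" "arc f' u t"
      using push[OF less.prems False] by blast
    have "card (V - insert u T) < card (V - T)"
      using f'(3) finite_V by (intro psubset_card_mono) auto
    then obtain f'' where f'': "proper3 f''" "\<forall>t\<in>insert u T. f'' t = f' t"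
      "\<forall>w\<in>V. \<exists>t\<in>insert u T. (arc f'')\<^sup>*\<^sup>* w t"
      using less.hyps[of "insert u T" f'] f' less.prems by blast
    have "arc f'' u t" using f'(4,5) f''(2) by (simp add: arc_def)
    then have "\<forall>w\<in>V. \<exists>t\<in>T. (arc f'')\<^sup>*\<^sup>* w t"
      using f''(3) f'(4) by (metis insert_iff rtranclp.rtrancl_into_rtrancl)
    then show ?thesis using f'' f'(2) by (metis insertCI)
  qed
qed

text \<open>Otherwise \<open>extend\<close> applied to \<open>Z\<close> gives every vertex an
  outgoing arc: inside \<open>Z\<close> the old arcs remain, and outside each vertex has a first
  step towards \<open>Z\<close>. Then nothing is stuck.\<close>

lemma no_trap:
  assumes f: "proper3 f" and Z: "Z \<subseteq> V" "Z \<noteq> {}"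
  shows "\<exists>z\<in>Z. \<forall>z'\<in>Z. \<not> arc f z z'"
proof (rule ccontr)
  assume "\<not> ?thesis"
  then have trap: "\<And>z. z \<in> Z \<Longrightarrow> \<exists>z'\<in>Z. arc f z z'" by blast
  obtain f' where f': "proper3 f'" "\<forall>t\<in>Z. f' t = f t" "\<forall>u\<in>V. \<exists>t\<in>Z. (arc f')\<^sup>*\<^sup>* u t"
    using extend[OF f Z] by blast
  have out: "\<exists>v. arc f' u v" if "u \<in> V" for u
  proof (cases "u \<in> Z")
    case True
    then show ?thesis using trap[OF True] f'(2) by (auto simp: arc_def)
  next
    case False
    then show ?thesis using f'(3) that by (metis converse_rtranclpE)
  qed
  obtain x where x: "stuck f' x" using ex_stuck f'(1) by blast
  obtain y where y: "arc f' x y" using out x unfolding stuck_def by blast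
  obtain z where z: "arc f' y z" using out y E_in unfolding arc_def by blast
  \<comment> \<open>Two consecutive arcs lower the colour by 2, which is nonzero modulo 3.\<close>
  have "f' z mod 3 = f' x mod 3" "f' x mod 3 = (f' y + 1) mod 3" "f' y mod 3 = (f' z + 1) mod 3"
    using x y z unfolding stuck_def arc_def by blast+
  then show False by (metis Suc_eq_plus1 mod3_Suc_eq mod3_asym)
qed

section \<open>Levellings by longest directed walks\<close>

text \<open>
  The levels of adjacent vertices differ by 1, 4, 7, and so on, so levels modulo 3 are a proper colouring.
\<close>

definition levelling :: "'a \<Rightarrow> ('a \<Rightarrow> nat) \<Rightarrow> bool" where
  "levelling r l \<longleftrightarrow> r \<in> V \<and> l r = 0 \<and> (\<forall>v\<in>V. v \<noteq> r \<longrightarrow> (\<exists>u. E v u \<and> l v = Suc (l u))) \<and>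
    (\<forall>u v. E u v \<longrightarrow> l v \<le> l u \<longrightarrow> l u mod 3 = (l v + 1) mod 3)"

text \<open>Koenig's argument: the vertices with arbitrarily long outgoing walks would form a set
  that \<open>no_trap\<close> forbids.\<close>

lemma bounded_walks:
  assumes f: "proper3 f" and u: "u \<in> V"
  shows "\<exists>n. \<forall>v. \<not> (arc f ^^ n) u v"
proof (rule ccontr)
  assume neg: "\<not> ?thesis"
  define W where "W n u \<longleftrightarrow> (\<exists>v. (arc f ^^ n) u v)" for n u
  define Z where "Z = {u\<in>V. \<forall>n. W n u}"
  have "u \<in> Z" using neg u unfolding Z_def W_def by blast
  have anti: "W m v" if "W n v" "m \<le> n" for m n v
    using that relpowp_shorten unfolding W_def by metis
  have "\<exists>z'\<in>Z. arc f z z'" if z: "z \<in> Z" for z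
  proof (rule ccontr)
    assume no: "\<not> ?thesis"
    have "\<forall>v\<in>V. \<exists>n. arc f z v \<longrightarrow> \<not> W n v" using no unfolding Z_def by blast
    then obtain N where N: "\<And>v. v \<in> V \<Longrightarrow> arc f z v \<Longrightarrow> \<not> W (N v) v" by metis
    \<comment> \<open>By finiteness one bound serves all out-neighbours of \<open>z\<close>; a walk
      of length \<open>Suc M\<close> from \<open>z\<close> violates it after its first step.\<close>
    define M where "M = Max (N ` V)"
    have "W (Suc M) z" using z unfolding Z_def by blast
    then obtain v where v: "arc f z v" "W M v" unfolding W_def by (meson relpowp_Suc_D2)
    have vV: "v \<in> V" using v E_in unfolding arc_def by blast
    then have "N v \<le> M" unfolding M_def using finite_V by simp
    then show False using anti[OF v(2)] N[OF vV v(1)] by blast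
  qed
  then show False using no_trap[OF f, of Z] \<open>u \<in> Z\<close> unfolding Z_def by blast
qed

lemma ex_levelling: "\<exists>r l. levelling r l"
proof -
  obtain f0 where f0: "proper3 f0" using colourable unfolding proper3_def by blast
  obtain r where r: "r \<in> V" using nonempty by blast
  obtain f where f: "proper3 f" "\<forall>u\<in>V. (arc f)\<^sup>*\<^sup>* u r"
    using extend[OF f0, of "{r}"] r by auto
  define W where "W n u \<longleftrightarrow> (\<exists>v. (arc f ^^ n) u v)" for n u
  have anti: "W m v" if "W n v" "m \<le> n" for m n v
    using that relpowp_shorten unfolding W_def by metis
  have bd: "\<exists>b. \<forall>n. W n u \<longrightarrow> n \<le> b" if u: "u \<in> V" for u
  proof -
    obtain b where "\<not> W b u" using bounded_walks[OF f(1) u] unfolding W_def by blast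
    then show ?thesis using anti by (meson nat_le_linear)
  qed
  \<comment> \<open>The length of a longest directed walk; \<open>bd\<close> guarantees that the
    maximum exists.\<close>
  define l where "l u = (GREATEST n. W n u)" for u
  have W0: "W 0 u" for u unfolding W_def by auto
  have Wl: "W (l u) u" if "u \<in> V" for u
    unfolding l_def using bd[OF that] GreatestI_nat[of "\<lambda>n. W n u" 0] W0 by blast
  have le: "n \<le> l u" if "u \<in> V" "W n u" for u n
    unfolding l_def using bd[OF that(1)] Greatest_le_nat[of "\<lambda>n. W n u"] that(2) by blast
  have arcl: "l v < l u" if a: "arc f u v" for u v
  proof -
    have V: "u \<in> V" "v \<in> V" using a E_in unfolding arc_def by auto
    have "W (Suc (l v)) u" using Wl[OF V(2)] a unfolding W_def by (meson relpowp_Suc_I2)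
    then show ?thesis using le[OF V(1)] by force
  qed
  have down: "\<exists>v. arc f u v \<and> l u = Suc (l v)" if u: "u \<in> V" "u \<noteq> r" for u
  proof -
    obtain w where "arc f u w" using f(2) u by (metis converse_rtranclpE)
    then have "l u \<noteq> 0" using arcl by force
    then obtain n where n: "l u = Suc n" by (metis not0_implies_Suc)
    then obtain v where v: "arc f u v" "W n v"
      using Wl[OF u(1)] unfolding W_def by (metis relpowp_Suc_D2)
    have "n \<le> l v" using le v E_in unfolding arc_def by blast
    then show ?thesis using v arcl[OF v(1)] n by (intro exI[of _ v]) auto
  qed
  \<comment> \<open>Were \<open>r\<close> to have an outgoing arc, every vertex would have one, and
    \<open>V\<close> itself would be a trap.\<close>
  have r0: "l r = 0"
  proof (rule ccontr)
    assume "l r \<noteq> 0"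
    have "\<exists>v\<in>V. arc f u v" if u: "u \<in> V" for u
    proof (cases "u = r")
      case True
      obtain n where "l r = Suc n" using \<open>l r \<noteq> 0\<close> by (metis not0_implies_Suc)
      then obtain v where "arc f r v" using Wl[OF r] unfolding W_def by (metis relpowp_Suc_D2)
      then show ?thesis using True E_in unfolding arc_def by blast
    next
      case False
      then show ?thesis using down u E_in unfolding arc_def by blast
    qed
    then show False using no_trap[OF f(1) order_refl nonempty] by blast
  qed
  \<comment> \<open>Each step of \<open>down\<close> lowers both colour and level by one, and the
    descent can only end at \<open>r\<close>.\<close>
  have col: "f u mod 3 = (f r + l u) mod 3" if "u \<in> V" for u
    using that
  proof (induction "l u" arbitrary: u)
    case 0
    then show ?case using down by fastforce
  next
    case (Suc n)
    then have "u \<noteq> r" using r0 by auto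
    then obtain v where v: "arc f u v" "l u = Suc (l v)" using down Suc.prems by blast
    then have "f v mod 3 = (f r + l v) mod 3" using Suc E_in unfolding arc_def by auto
    moreover have "f u mod 3 = (f v mod 3 + 1) mod 3"
      using v unfolding arc_def by (simp add: mod_simps)
    ultimately show ?case unfolding v(2) by (simp add: mod_simps)
  qed
  have "l u mod 3 = (l v + 1) mod 3" if e: "E u v" "l v \<le> l u" for u v
  proof -
    have "f u mod 3 \<noteq> f v mod 3" using f(1) e(1) unfolding proper3_def by blast
    then have "f u mod 3 = (f v + 1) mod 3 \<or> f v mod 3 = (f u + 1) mod 3" using mod3_trichotomy by blast
    then consider "f u mod 3 = (f v + 1) mod 3" | "f v mod 3 = (f u + 1) mod 3" by blast
    then show ?thesis
    proof cases
      case 1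
      moreover have "f u mod 3 = (f r + l u) mod 3" "f v mod 3 = (f r + l v) mod 3"
        using col E_in[OF e(1)] by blast+
      ultimately have "(f r + l u) mod 3 = (f r + (l v + 1)) mod 3"
        by (metis add.assoc mod_add_left_eq)
      then show ?thesis by (rule mod3_add_left_cancel)
    next
      case 2
      then have "arc f v u" using e(1) E_sym unfolding arc_def by blast
      then show ?thesis using arcl e(2) by fastforce
    qed
  qed
  then have "levelling r l"
    unfolding levelling_def using r r0 down arc_def by blast
  then show ?thesis by blast
qed

lemma level_down:
  assumes "levelling r l" "v \<in> V" "n \<le> l v"
  shows "\<exists>u\<in>V. l u = n"
  using assms(3)
proof (induction rule: inc_induct)
  case base
  then show ?case using assms by blast
next
  case (step k)
  then obtain u where u: "u \<in> V" "l u = Suc k" by blast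
  then have "u \<noteq> r" using assms(1) unfolding levelling_def by auto
  then show ?case using assms(1) u E_in unfolding levelling_def by (metis nat.inject)
qed

text \<open>All levels below \<open>l v\<close> are occupied too, so \<open>l\<close> takes at least
  \<open>l v + 1\<close> values.\<close>

lemma level_less_card:
  assumes "levelling r l" "v \<in> V"
  shows "l v < card V"
proof -
  have "{..l v} \<subseteq> l ` V" using level_down[OF assms] by auto
  then have "card {..l v} \<le> card V"
    using finite_V by (meson card_image_le card_mono finite_imageI le_trans)
  then show ?thesis by simp
qed

section \<open>Maximal height and stuck vertices\<close>

text \<open>The maximum ranges over all roots and all levellings; it exists because levels stay
  below \<open>card V\<close>.\<close>

definition height :: nat where
  "height = (GREATEST n. \<exists>r l v. levelling r l \<and> v \<in> V \<and> l v = n)"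

definition tall :: "'a \<Rightarrow> ('a \<Rightarrow> nat) \<Rightarrow> bool" where
  "tall r l \<longleftrightarrow> levelling r l \<and> (\<exists>v\<in>V. l v = height)"

lemma height_bound:
  "\<exists>r l v. levelling r l \<and> v \<in> V \<and> l v = n \<Longrightarrow> n \<le> card V"
  using level_less_card less_imp_le by blast

lemma level_le_height:
  assumes "levelling r l" "v \<in> V"
  shows "l v \<le> height"
  unfolding height_def
proof (rule Greatest_le_nat)
  show "\<exists>r' l' v'. levelling r' l' \<and> v' \<in> V \<and> l' v' = l v" using assms by blast
qed (rule height_bound)

lemma ex_tall: "\<exists>r l. tall r l"
proof -
  obtain r l where l: "levelling r l" using ex_levelling by blast
  obtain v where v: "v \<in> V" using nonempty by blast
  have "\<exists>r l v. levelling r l \<and> v \<in> V \<and> l v = height"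
    unfolding height_def
  proof (rule GreatestI_nat)
    show "\<exists>r' l' v'. levelling r' l' \<and> v' \<in> V \<and> l' v' = l v" using l v by blast
  qed (rule height_bound)
  then show ?thesis unfolding tall_def by blast
qed

lemma root_in: "levelling r l \<Longrightarrow> r \<in> V"
  and root_level: "levelling r l \<Longrightarrow> l r = 0"
  and parent: "levelling r l \<Longrightarrow> v \<in> V \<Longrightarrow> v \<noteq> r \<Longrightarrow> \<exists>u. E v u \<and> l v = Suc (l u)"
  and edge_mod: "levelling r l \<Longrightarrow> E u v \<Longrightarrow> l v \<le> l u \<Longrightarrow> l u mod 3 = (l v + 1) mod 3"
  unfolding levelling_def by blast+

lemma level_0: "levelling r l \<Longrightarrow> v \<in> V \<Longrightarrow> l v = 0 \<Longrightarrow> v = r"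
  using parent by fastforce

lemma edge_cases:
  assumes "levelling r l" "E u v"
  shows "l v < l u \<and> l u mod 3 = (l v + 1) mod 3 \<or> l u < l v \<and> l v mod 3 = (l u + 1) mod 3"
proof -
  have "l u \<noteq> l v"
  proof
    assume "l u = l v"
    then show False using edge_mod[OF assms] by (simp add: mod3_neq_Suc)
  qed
  then consider "l v < l u" | "l u < l v" by linarith
  then show ?thesis
    using edge_mod[OF assms] edge_mod[OF assms(1) E_sym[OF assms(2)]] by cases auto
qed

lemma levelling_proper:
  assumes "levelling r l"
  shows "proper3 l"
  unfolding proper3_def
proof (intro allI impI)
  fix u v assume "E u v"
  then have "l u mod 3 = (l v + 1) mod 3 \<or> l v mod 3 = (l u + 1) mod 3"
    using edge_cases[OF assms] by blast
  then show "l u mod 3 \<noteq> l v mod 3"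
  proof
    assume "l u mod 3 = (l v + 1) mod 3"
    then show ?thesis by (simp add: mod3_Suc_neq)
  next
    assume "l v mod 3 = (l u + 1) mod 3"
    then show ?thesis by (simp add: mod3_neq_Suc)
  qed
qed

lemma edge_less:
  assumes "levelling r l" "E u v" "l u mod 3 = (l v + 1) mod 3"
  shows "l v < l u"
proof (rule ccontr)
  assume "\<not> l v < l u"
  then have "l v mod 3 = (l u + 1) mod 3" using edge_cases[OF assms(1,2)] by blast
  then show False using assms(3) mod3_asym by blast
qed

text \<open>With all levels at most 3, every edge joins consecutive levels, so parity of the level
  would be a bipartition.\<close>

lemma height_ge_4: "4 \<le> height"
proof (rule ccontr)
  assume low: "\<not> 4 \<le> height"
  obtain r l where l: "levelling r l" using ex_levelling by blast
  have "even (l u) \<noteq> even (l v)" if e: "E u v" for u v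
  proof -
    have b: "l u \<le> 3" "l v \<le> 3" using level_le_height[OF l] E_in[OF e] low by fastforce+
    show ?thesis using edge_cases[OF l e]
    proof
      assume "l v < l u \<and> l u mod 3 = (l v + 1) mod 3"
      then have "l u = Suc (l v)" using b mod3_small by blast
      then show ?thesis by simp
    next
      assume "l u < l v \<and> l v mod 3 = (l u + 1) mod 3"
      then have "l v = Suc (l u)" using b mod3_small by blast
      then show ?thesis by simp
    qed
  qed
  then have "\<exists>h :: 'a \<Rightarrow> bool. \<forall>u v. E u v \<longrightarrow> h u \<noteq> h v"
    by (intro exI[of _ "\<lambda>v. even (l v)"]) blast
  then show False using not_bipartite by blast
qed

lemma level_exists: "tall r l \<Longrightarrow> n \<le> height \<Longrightarrow> \<exists>v\<in>V. l v = n"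
  unfolding tall_def using level_down by metis

text \<open>Supplies a vertex of level 2 two steps from the root, so the root is never stuck; the
  vertex of level 3 shows that \<open>z\<close> is not a source.\<close>

lemma chain_at_root:
  assumes "tall r l"
  shows "\<exists>w z y. E w z \<and> E z y \<and> E y r \<and> l w = 3 \<and> l z = 2 \<and> l y = 1"
proof -
  have l: "levelling r l" using assms unfolding tall_def by blast
  obtain w where w: "w \<in> V" "l w = 3" using level_exists[OF assms, of 3] height_ge_4 by auto
  then obtain z where z: "E w z" "l z = 2" using parent[OF l, of w] root_level[OF l] by fastforce
  then obtain y where y: "E z y" "l y = 1"
    using parent[OF l, of z] root_level[OF l] E_in by fastforce
  then obtain q where q: "E y q" "l q = 0"
    using parent[OF l, of y] root_level[OF l] E_in by fastforce
  then have "q = r" using level_0[OF l] E_in by blast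
  then show ?thesis using w z y q by blast
qed

text \<open>From level 2 or more, two parent steps change the colour by 2. From the root,
  \<open>chain_at_root\<close> does so.\<close>

lemma stuck_level:
  assumes "tall r l" "stuck l b"
  shows "l b = 1"
proof -
  have l: "levelling r l" using assms unfolding tall_def by blast
  have bV: "b \<in> V" using assms(2) unfolding stuck_def by blast
  have st: "l z mod 3 = l b mod 3" if "E b y" "E y z" for y z
    using assms(2) that unfolding stuck_def by blast
  have "l b \<noteq> 0"
  proof
    assume "l b = 0"
    then have "b = r" using level_0 l bV by blast
    then show False using chain_at_root[OF assms(1)] st E_sym root_level[OF l] by fastforce
  qed
  moreover have "\<not> 2 \<le> l b"
  proof
    assume two: "2 \<le> l b"
    then obtain y where y: "E b y" "l b = Suc (l y)" using parent[OF l bV] root_level[OF l] by fastforce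
    then have "y \<noteq> r" "y \<in> V" using two root_level[OF l] E_in by auto
    then obtain z where z: "E y z" "l y = Suc (l z)" using parent[OF l] by blast
    have "l z mod 3 = Suc (Suc (l z)) mod 3" using st[OF y(1) z(1)] y(2) z(2) by simp
    then show False using mod3_neq_Suc2 by blast
  qed
  ultimately show ?thesis by linarith
qed

lemma stuck_root:
  assumes "tall r l" "stuck l b"
  shows "E b r"
proof -
  have l: "levelling r l" using assms unfolding tall_def by blast
  have "b \<in> V" "b \<noteq> r"
    using assms stuck_level[OF assms] root_level[OF l] unfolding stuck_def by auto
  then obtain u where "E b u" "l u = 0" using parent[OF l] stuck_level[OF assms] by fastforce
  then show ?thesis using level_0[OF l] E_in by blast
qed

text \<open>All neighbours of \<open>y\<close> share the colour 1 of \<open>b\<close>. The parent of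
  \<open>y\<close> is one of them, so \<open>y\<close> has colour 2 and every edge at
  \<open>y\<close> leads down.\<close>

lemma stuck_nbr:
  assumes "tall r l" "stuck l b" "E b y" "y \<noteq> r"
  shows "l y mod 3 = 2" and "E y z \<Longrightarrow> l z < l y" and "E y z \<Longrightarrow> l z mod 3 = 1"
proof -
  have l: "levelling r l" using assms unfolding tall_def by blast
  have st: "l z mod 3 = 1" if "E y z" for z
    using assms stuck_level[OF assms(1,2)] that unfolding stuck_def by fastforce
  have yV: "y \<in> V" using assms E_in by blast
  obtain z0 where z0: "E y z0" "l y = Suc (l z0)" using parent[OF l yV assms(4)] by blast
  show 2: "l y mod 3 = 2" using st[OF z0(1)] z0(2) by (simp add: mod_Suc)
  show "l z < l y" if "E y z"
    by (rule edge_less[OF l that]) (use st[OF that] 2 in \<open>simp add: mod_Suc\<close>)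
  show "E y z \<Longrightarrow> l z mod 3 = 1" by (rule st)
qed

section \<open>Rotating to a new root\<close>

text \<open>For a stuck \<open>b\<close>, modulo 3 this is a uniform shift by one, plus one more on
  \<open>b\<close> and its neighbours other than \<open>r\<close>. The old root becomes an ordinary
  vertex of level 1.\<close>

definition rotate :: "'a \<Rightarrow> 'a \<Rightarrow> ('a \<Rightarrow> nat) \<Rightarrow> 'a \<Rightarrow> nat" where
  "rotate r b l v = (if v = b then 0 else if E b v \<and> v \<noteq> r then 1 else Suc (l v))"

lemma rotate_root: "rotate r b l b = 0"
  and rotate_nbr: "v \<noteq> b \<Longrightarrow> E b v \<Longrightarrow> v \<noteq> r \<Longrightarrow> rotate r b l v = 1"
  and rotate_other: "v \<noteq> b \<Longrightarrow> \<not> (E b v \<and> v \<noteq> r) \<Longrightarrow> rotate r b l v = Suc (l v)"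
  unfolding rotate_def by auto

lemma irrefl: "\<not> E v v"
  using colourable by blast

lemma rotate_levelling:
  assumes t: "tall r l" and b: "stuck l b"
  shows "levelling b (rotate r b l)"
proof -
  have l: "levelling r l" using t unfolding tall_def by blast
  have bV: "b \<in> V" using b unfolding stuck_def by blast
  have br: "E b r" using stuck_root[OF t b] .
  note nb = stuck_nbr[OF t b]
  let ?l = "rotate r b l"
  have par: "\<exists>u. E v u \<and> ?l v = Suc (?l u)" if v: "v \<in> V" "v \<noteq> b" for v
  proof (cases "E b v")
    case True
    then have "?l v = Suc (?l b)" using v root_level[OF l] by (simp add: rotate_def)
    then show ?thesis using True E_sym by blast
  next
    case False
    then have "v \<noteq> r" using br by blast
    then obtain u where u: "E v u" "l v = Suc (l u)" using parent[OF l v(1)] by blast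
    \<comment> \<open>Sources adjacent to \<open>b\<close> lie above all their neighbours, so none
      of them is the parent of \<open>v\<close>.\<close>
    have "\<not> (E b u \<and> u \<noteq> r)"
    proof
      assume "E b u \<and> u \<noteq> r"
      then have "l v < l u" using nb(2) E_sym[OF u(1)] by blast
      then show False using u(2) by simp
    qed
    moreover have "u \<noteq> b" using u(1) False E_sym by blast
    ultimately have "?l u = Suc (l u)" by (intro rotate_other)
    moreover have "?l v = Suc (l v)" using v(2) False by (intro rotate_other) blast+
    ultimately have "?l v = Suc (?l u)" using u(2) by simp
    then show ?thesis using u(1) by blast
  qed
  have edge: "?l u mod 3 = (?l v + 1) mod 3" if e: "E u v" "?l v \<le> ?l u" for u v
  proof -
    show ?thesis
    proof (cases "u = b \<or> v = b")
      case True
      show ?thesis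
      proof (cases "u = b")
        case True
        then have "?l v = 0" using e(2) by (simp add: rotate_root)
        then have "v = b" unfolding rotate_def by (metis zero_neq_one nat.distinct(1))
        then show ?thesis using True e(1) irrefl by blast
      next
        case False
        then have v: "v = b" using True by blast
        have "?l u = 1"
          using rotate_nbr[OF False, of r l] rotate_other[OF False, of r l] root_level[OF l]
            E_sym[OF e(1)] v by (cases "u = r") auto
        then show ?thesis using v by (simp add: rotate_root)
      qed
    next
      case False
      then have ub: "u \<noteq> b" and vb: "v \<noteq> b" by auto
      show ?thesis
      proof (cases "E b u \<and> u \<noteq> r")
        case True
        have m: "l v mod 3 = 1" using nb(3)[of u v] True e(1) by blast
        then have "\<not> (E b v \<and> v \<noteq> r)" using nb(1)[of v] by auto
        then have lv: "?l v = Suc (l v)" by (rule rotate_other[OF vb])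
        have lu: "?l u = 1" using rotate_nbr[OF ub] True by blast
        \<comment> \<open>A vacuous case: level 0 contradicts the residue 1 found in
          \<open>m\<close>.\<close>
        have "l v = 0" using e(2) lu lv by simp
        then show ?thesis using m by simp
      next
        case u: False
        then have lu: "?l u = Suc (l u)" by (rule rotate_other[OF ub])
        show ?thesis
        proof (cases "E b v \<and> v \<noteq> r")
          case True
          have "l u mod 3 = 1" using nb(3)[of v u] True E_sym[OF e(1)] by blast
          then have "Suc (l u) mod 3 = 2" by (simp add: mod_Suc)
          moreover have "?l v = 1" using rotate_nbr[OF vb] True by blast
          ultimately show ?thesis using lu by simp
        next
          case False
          then have lv: "?l v = Suc (l v)" by (rule rotate_other[OF vb])
          have "l u mod 3 = (l v + 1) mod 3" using edge_mod[OF l e(1)] e(2) lu lv by simp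
          then show ?thesis unfolding lu lv by (simp add: mod3_Suc_eq)
        qed
      qed
    qed
  qed
  show ?thesis unfolding levelling_def using bV par edge rotate_root by blast
qed

text \<open>Otherwise the rotation would lift \<open>v\<close> to level
  \<open>height + 1\<close>.\<close>

lemma top_nbr:
  assumes t: "tall r l" and b: "stuck l b" and v: "v \<in> V" "l v = height"
  shows "E b v" and "v \<noteq> r"
proof -
  have "v \<noteq> b" using stuck_level[OF t b] v height_ge_4 by auto
  moreover have "rotate r b l v \<le> height" using level_le_height[OF rotate_levelling[OF t b] v(1)] .
  ultimately have "E b v \<and> v \<noteq> r" using v(2) by (auto simp: rotate_def split: if_splits)
  then show "E b v" "v \<noteq> r" by blast+
qed

text \<open>Top vertices are neighbours of a stuck vertex other than the root, so they have colour
  2.\<close>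

lemma height_mod: "height mod 3 = 2"
proof -
  obtain r l where t: "tall r l" using ex_tall by blast
  then obtain v where v: "v \<in> V" "l v = height" unfolding tall_def by blast
  obtain b where b: "stuck l b"
    using ex_stuck levelling_proper t unfolding tall_def by blast
  show ?thesis using stuck_nbr(1)[OF t b top_nbr[OF t b v]] v(2) by simp
qed

lemma pred_height_mod: "(height - 1) mod 3 = 1"
  using height_mod by (cases height) (auto simp: mod_Suc split: if_splits)

lemma height_ge_5: "5 \<le> height"
proof -
  have "height \<noteq> 4" using height_mod by auto
  then show ?thesis using height_ge_4 by simp
qed

text \<open>Level \<open>height - 1\<close> has residue 1, whereas the sources next to
  \<open>b\<close> have residue 2. Hence its vertices rise by one, while the lowered vertices end at
  level 0 or 1.\<close>

lemma rotate_top: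
  assumes t: "tall r l" and b: "stuck l b"
  shows "rotate r b l v = height \<longleftrightarrow> l v = height - 1"
proof
  assume "rotate r b l v = height"
  then show "l v = height - 1" using height_ge_5 by (auto simp: rotate_def split: if_splits)
next
  assume v: "l v = height - 1"
  have "\<not> (E b v \<and> v \<noteq> r)" using stuck_nbr(1)[OF t b, of v] v pred_height_mod by auto
  moreover have "v \<noteq> b" using stuck_level[OF t b] v height_ge_5 by auto
  ultimately show "rotate r b l v = height" using v height_ge_5 by (auto simp: rotate_def)
qed

lemma rotate_tall: "tall r l \<Longrightarrow> stuck l b \<Longrightarrow> tall b (rotate r b l)"
  using rotate_levelling rotate_top level_exists[of r l "height - 1"]
  unfolding tall_def[of b] by (metis diff_le_self)

lemma ex_stuck_tall: "tall r l \<Longrightarrow> \<exists>b. stuck l b"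
  using ex_stuck levelling_proper unfolding tall_def by blast

text \<open>The next stuck vertex is adjacent to the new root \<open>b\<close>, and stepping back to
  the old root is impossible, so rotations keep moving onwards.\<close>

lemma next_stuck:
  assumes t: "tall r l" and b: "stuck l b" and s: "stuck (rotate r b l) s"
  shows "E b s" and "s \<noteq> r"
proof -
  have l: "levelling r l" using t unfolding tall_def by blast
  note t' = rotate_tall[OF t b]
  show "E b s" using stuck_root[OF t' s] E_sym by blast
  show "s \<noteq> r"
  proof
    assume sr: "s = r"
    \<comment> \<open>If \<open>s\<close> were \<open>r\<close>, then \<open>y\<close> would be a
      source in the rotated levelling. But \<open>z\<close> and \<open>y\<close> both rise by one,
      so \<open>z\<close> stays above \<open>y\<close>.\<close>
    obtain w z y where c: "E w z" "E z y" "E y r" "l w = 3" "l z = 2" "l y = 1"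
      using chain_at_root[OF t] by blast
    have zr: "z \<noteq> r" using c(5) root_level[OF l] by auto
    have nz: "\<not> E b z" using stuck_nbr(2)[OF t b _ zr E_sym[OF c(1)]] c(4,5) by auto
    then have yb: "y \<noteq> b" using E_sym[OF c(2)] by blast
    have zb: "z \<noteq> b" using stuck_level[OF t b] c(5) by auto
    have ny: "\<not> E b y \<or> y = r" using stuck_nbr(1)[OF t b, of y] c(6) by auto
    have "rotate r b l z < rotate r b l y"
      using stuck_nbr(2)[OF t' s _ yb E_sym[OF c(2)]] sr E_sym[OF c(3)] by blast
    then show False using nz ny yb zb c(5,6) by (auto simp: rotate_def)
  qed
qed

section \<open>Recolouring just below the top\<close>

text \<open>If \<open>x\<close> and \<open>f\<close> were not adjacent, raising the colour of
  \<open>x\<close> and of the top vertices adjacent to \<open>x\<close> by one would leave nothing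
  stuck.\<close>

lemma top_complete:
  assumes t: "tall r l" and b: "stuck l b" and f: "E b f" "f \<noteq> r"
    and x: "x \<in> V" "l x = height - 1"
  shows "E x f"
proof (rule ccontr)
  assume nf: "\<not> E x f"
  have l: "levelling r l" using t unfolding tall_def by blast
  note t' = rotate_tall[OF t b]
  \<comment> \<open>Rotation makes \<open>x\<close> a top vertex, hence adjacent to the next stuck
    vertex. This yields a common neighbour \<open>s\<close> of \<open>b\<close> and
    \<open>x\<close>.\<close>
  obtain s where s: "stuck (rotate r b l) s" using ex_stuck_tall[OF t'] by blast
  have bs: "E b s" "s \<noteq> r" using next_stuck[OF t b s] by auto
  have sx: "E s x" using top_nbr(1)[OF t' s x(1)] rotate_top[OF t b] x(2) by blast
  have "l x < l s" using stuck_nbr(2)[OF t b bs sx] .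
  moreover have "l s \<le> height" using level_le_height[OF l] bs E_in by blast
  ultimately have ls: "l s = height" using x(2) by simp
  have xm: "l x mod 3 = 1" using x(2) pred_height_mod by simp
  have lb: "l b = 1" using stuck_level[OF t b] .
  define A where "A = insert x {u. E x u \<and> l u = height}"
  define g where "g v = (if v \<in> A then Suc (l v) else l v)" for v
  have low: "v \<notin> A" if "l v < height - 1" for v using that x(2) unfolding A_def by auto
  have gx: "g x mod 3 = 2" using x(2) height_mod height_ge_5 unfolding g_def A_def by auto
  \<comment> \<open>Only an arc entering \<open>A\<close> could spoil the shift. Its tail would be a
    top vertex adjacent to \<open>x\<close>, hence already in \<open>A\<close>.\<close>
  have cross: "Suc (l u) mod 3 \<noteq> l v mod 3" if e: "E u v" "u \<in> A" "v \<notin> A" for u v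
  proof
    assume m: "Suc (l u) mod 3 = l v mod 3"
    have lt: "l u < l v" by (rule edge_less[OF l E_sym[OF e(1)]]) (use m in simp)
    have le: "l v \<le> height" using level_le_height[OF l] E_in e by blast
    show False using e lt le x(2) unfolding A_def by auto
  qed
  have "proper3 g"
    unfolding proper3_def
  proof (intro allI impI)
    fix u v assume e: "E u v"
    have p: "l u mod 3 \<noteq> l v mod 3" using levelling_proper[OF l] e unfolding proper3_def by blast
    then have "Suc (l u) mod 3 \<noteq> Suc (l v) mod 3" by (simp add: mod3_Suc_eq)
    then show "g u mod 3 \<noteq> g v mod 3"
      using p cross[OF e] cross[OF E_sym[OF e]] unfolding g_def by auto
  qed
  then obtain v where v: "stuck g v" using ex_stuck by blast
  have vV: "v \<in> V" using v unfolding stuck_def by blast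
  have st: "g z mod 3 = g v mod 3" if "E v y" "E y z" for y z
    using v that unfolding stuck_def by blast
  have top: "g y mod 3 = 0" if "E x y" "l y = height" for y
    using that height_mod unfolding g_def A_def by (simp add: mod_Suc)
  consider "v = x" | "v \<noteq> x" "v \<in> A" | "v \<notin> A" "2 \<le> l v" | "v \<notin> A" "l v = 0" | "v \<notin> A" "l v = 1"
    by linarith
  then show False
  proof cases
    case 1
    have "g b = 1" using low[of b] lb height_ge_5 unfolding g_def by simp
    then show False using st[of s b] 1 sx bs gx E_sym by fastforce
  next
    case 2
    then have xv: "E x v" "l v = height" unfolding A_def by auto
    \<comment> \<open>The assumed non-adjacency enters here: \<open>f\<close> keeps colour 2, while
      \<open>v\<close>, two steps away through \<open>b\<close>, now has colour 0.\<close>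
    have fm: "l f mod 3 = 2" using stuck_nbr(1)[OF t b f] .
    then have "f \<notin> A" using nf xm unfolding A_def by auto
    then have "g f mod 3 = 2" using fm unfolding g_def by simp
    moreover have "E v b" using top_nbr(1)[OF t b vV xv(2)] E_sym by blast
    ultimately show False using st[OF _ f(1)] top[OF xv] by simp
  next
    case 3
    then obtain y where y: "E v y" "l v = Suc (l y)"
      using parent[OF l vV] root_level[OF l] by fastforce
    then have "y \<noteq> r" "y \<in> V" using 3 root_level[OF l] E_in by auto
    then obtain z where z: "E y z" "l y = Suc (l z)" using parent[OF l] by blast
    have "l v \<le> height" using level_le_height[OF l vV] .
    \<comment> \<open>Two levels below \<open>v\<close> is too low for \<open>A\<close>, so neither
      end of the descent is recoloured.\<close>
    then have "z \<notin> A" using low y(2) z(2) by simp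
    then have "l z mod 3 = Suc (Suc (l z)) mod 3"
      using st[OF y(1) z(1)] 3 y(2) z(2) unfolding g_def by simp
    then show False using mod3_neq_Suc2 by blast
  next
    case 4
    then have vr: "v = r" using level_0[OF l vV] by blast
    obtain z y where c: "E z y" "E y r" "l z = 2" using chain_at_root[OF t] by blast
    have "g z = 2" using c(3) low[of z] height_ge_5 unfolding g_def by simp
    moreover have "g v = 0" using 4 unfolding g_def by simp
    ultimately show False using st[OF _ E_sym[OF c(1)]] vr E_sym[OF c(2)] by simp
  next
    case 5
    then have gv: "g v = 1" unfolding g_def by simp
    \<comment> \<open>The raised \<open>x\<close> has colour 2, so a vertex of colour 1 sharing a
      neighbour with \<open>x\<close> is not stuck.\<close>
    have via_top: False if "E v y" "E x y" for y
      using st[OF that(1) E_sym[OF that(2)]] gv gx by simp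
    have notx: "\<not> E v x"
      using levelling_proper[OF l] 5(2) xm unfolding proper3_def by fastforce
    show False
    proof (cases "stuck l v")
      case True
      have "E v s" using top_nbr(1)[OF t True _ ls] E_in bs by blast
      then show False using via_top sx E_sym by blast
    next
      case False
      then obtain y z where yz: "E v y" "E y z" "l z mod 3 \<noteq> 1"
        using 5(2) vV unfolding stuck_def by auto
      \<comment> \<open>The old witness \<open>z\<close> keeps its colour: \<open>x\<close> has
        colour 1, and a top vertex \<open>z\<close> would give \<open>y\<close> colour 1, the colour
        of its neighbour \<open>v\<close>.\<close>
      have "z \<notin> A"
      proof
        assume "z \<in> A"
        then have lz: "l z = height" using yz(3) xm unfolding A_def by auto
        have "l y \<le> height" using level_le_height[OF l] yz E_in by blast
        then have "height mod 3 = (l y + 1) mod 3" using edge_cases[OF l yz(2)] lz by auto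
        then have "l y mod 3 = 1" using height_mod by (auto simp: mod_Suc split: if_splits)
        then show False using levelling_proper[OF l] yz(1) 5(2) unfolding proper3_def by fastforce
      qed
      then show False using st[OF yz(1,2)] gv yz(3) unfolding g_def by simp
    qed
  qed
qed

text \<open>By \<open>top_complete\<close> the source \<open>f\<close> has a neighbour of level
  \<open>height - 1\<close>, and it lies above that neighbour.\<close>

lemma nbr_top:
  assumes t: "tall r l" and b: "stuck l b" and f: "E b f" "f \<noteq> r"
  shows "l f = height"
proof -
  obtain x where x: "x \<in> V" "l x = height - 1" using level_exists[OF t, of "height - 1"] by auto
  have "l x < l f" using stuck_nbr(2)[OF t b f E_sym[OF top_complete[OF t b f x]]] .
  moreover have "l f \<le> height"
    using level_le_height t f E_in unfolding tall_def by blast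
  ultimately show ?thesis using x(2) by simp
qed

lemma two_nbrs:
  assumes t: "tall r l" and b: "stuck l b" and s: "stuck (rotate r b l) s"
  shows "E b v \<longleftrightarrow> v = r \<or> v = s"
proof -
  note t1 = rotate_tall[OF t b]
  note t2 = rotate_tall[OF t1 s]
  \<comment> \<open>The stuck vertex after two rotations has original level
    \<open>height - 1\<close>, so \<open>top_complete\<close> joins it to every neighbour of
    \<open>b\<close> except \<open>r\<close>.\<close>
  obtain q where q: "stuck (rotate b s (rotate r b l)) q" using ex_stuck_tall[OF t2] by blast
  have sq: "E s q" "q \<noteq> b" using next_stuck[OF t1 s q] by auto
  have lq: "l q = height - 1" using nbr_top[OF t1 s sq] rotate_top[OF t b] by blast
  have "v = s" if v: "E b v" "v \<noteq> r"
  proof (rule ccontr)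
    assume vs: "v \<noteq> s"
    have "E q v" using top_complete[OF t b v _ lq] sq E_in by blast
    then have "rotate b s (rotate r b l) v = height" using nbr_top[OF t2 q _ vs] by blast
    moreover have "v \<noteq> b" using v(1) irrefl by blast
    then have "rotate r b l v = 1" using rotate_nbr v by blast
    \<comment> \<open>A third neighbour \<open>v\<close> was lowered to level 1 and rises at most
      once more, yet \<open>nbr_top\<close> at \<open>q\<close> puts it at the top.\<close>
    then have "rotate b s (rotate r b l) v \<le> 2"
      using vs by (cases "E s v \<and> v \<noteq> b") (auto simp: rotate_nbr rotate_other)
    ultimately show False using height_ge_5 by simp
  qed
  moreover have "E b r" "E b s" using stuck_root[OF t b] next_stuck(1)[OF t b s] .
  ultimately show ?thesis by metis
qed

section \<open>The graph is a cycle\<close>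

text \<open>Forgetting the levelling leaves only finitely many pairs of a root and a stuck
  vertex.\<close>

definition follows :: "'a \<Rightarrow> 'a \<Rightarrow> bool" where
  "follows r b \<longleftrightarrow> (\<exists>l. tall r l \<and> stuck l b)"

lemma follows_step:
  assumes "follows r b"
  shows "\<exists>s. s \<noteq> r \<and> (\<forall>v. E b v \<longleftrightarrow> v = r \<or> v = s) \<and> follows b s"
proof -
  obtain l where t: "tall r l" and b: "stuck l b" using assms unfolding follows_def by blast
  obtain s where s: "stuck (rotate r b l) s" using ex_stuck_tall[OF rotate_tall[OF t b]] by blast
  show ?thesis
    using next_stuck(2)[OF t b s] two_nbrs[OF t b s] rotate_tall[OF t b] s
    unfolding follows_def by blast
qed

text \<open>The neighbours of a stuck vertex are its root and the next stuck vertex. Both are stuck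
  for some tall levelling, so by connectedness every vertex is.\<close>

lemma two_regular:
  assumes "v \<in> V"
  shows "\<exists>a c. a \<noteq> c \<and> (\<forall>w. E v w \<longleftrightarrow> w = a \<or> w = c)"
proof -
  define P where "P = {p. follows (fst p) (snd p)}"
  obtain succ where succ: "\<And>r b. follows r b \<Longrightarrow> succ r b \<noteq> r \<and>
      (\<forall>v. E b v \<longleftrightarrow> v = r \<or> v = succ r b) \<and> follows b (succ r b)"
    using follows_step by metis
  \<comment> \<open>This map is injective on a finite set, hence every root has itself been stuck.\<close>
  define nx where "nx p = (snd p, succ (fst p) (snd p))" for p
  have "P \<subseteq> V \<times> V"
    unfolding P_def follows_def stuck_def tall_def using root_in by (auto simp: mem_Times_iff)
  then have fin: "finite P" using finite_V by (meson finite_SigmaI finite_subset)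
  have into: "nx ` P \<subseteq> P" using succ unfolding P_def nx_def by auto
  have inj: "inj_on nx P"
  proof (rule inj_onI)
    fix p p' assume p: "p \<in> P" "p' \<in> P" and eq: "nx p = nx p'"
    obtain r b r' b' where pp: "p = (r, b)" "p' = (r', b')" by fastforce
    have "b = b'" "succ r b = succ r' b'" using eq pp unfolding nx_def by auto
    \<comment> \<open>\<open>b\<close> has just two neighbours, so its successor determines the
      other one.\<close>
    then have "r = r'" using succ[of r b] succ[of r' b'] p pp unfolding P_def by auto
    then show "p = p'" using pp \<open>b = b'\<close> by simp
  qed
  have surj: "nx ` P = P" using endo_inj_surj[OF fin into inj] .
  define X where "X = {b. \<exists>r. follows r b}"
  have "X = V"
  proof (rule nbr_closed_eq_V)
    show "X \<subseteq> V" unfolding X_def follows_def stuck_def by blast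
    show "X \<noteq> {}" using ex_tall ex_stuck_tall unfolding X_def follows_def by blast
    fix u w assume u: "u \<in> X" and e: "E u w"
    then obtain r where r: "follows r u" unfolding X_def by blast
    then have "w = r \<or> w = succ r u" using succ e by blast
    moreover have "succ r u \<in> X" using succ[OF r] unfolding X_def by blast
    moreover have "r \<in> X"
    proof -
      have "(r, u) \<in> nx ` P" using r surj unfolding P_def by simp
      then obtain p where "p \<in> P" "nx p = (r, u)" by force
      then have "follows (fst p) r" unfolding P_def nx_def by auto
      then show ?thesis unfolding X_def by blast
    qed
    ultimately show "w \<in> X" by blast
  qed
  then obtain r where "follows r v" using assms unfolding X_def by blast
  then show ?thesis using succ by metis
qed

lemma nbrs_eq:
  assumes "E v a" "E v c" "a \<noteq> c"
  shows "E v w \<longleftrightarrow> w = a \<or> w = c"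
proof -
  obtain p q where "\<forall>w. E v w \<longleftrightarrow> w = p \<or> w = q" using two_regular E_in assms(1) by metis
  then show ?thesis using assms by metis
qed

text \<open>Parents lead from the top vertex \<open>s\<close> through every level down to
  \<open>r\<close>, and \<open>b\<close> closes the cycle. By two-regularity this cycle is closed
  under adjacency, hence is everything.\<close>

lemma cyclic_enumeration:
  obtains l w where "\<And>i. i \<le> height \<Longrightarrow> l (w i) = height - i" and "l (w (Suc height)) = 1"
    and "bij_betw w {0..<height + 2} V"
    and "\<And>i j. i < height + 2 \<Longrightarrow> j < height + 2 \<Longrightarrow>
      E (w i) (w j) \<longleftrightarrow> cycle_graph (height + 2) i j"
proof -
  obtain r l where t: "tall r l" using ex_tall by blast
  then have l: "levelling r l" unfolding tall_def by blast
  obtain b where b: "stuck l b" using ex_stuck_tall[OF t] by blast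
  obtain s where s: "stuck (rotate r b l) s" using ex_stuck_tall[OF rotate_tall[OF t b]] by blast
  note nb = two_nbrs[OF t b s]
  have bs: "E b s" "s \<noteq> r" using next_stuck[OF t b s] by auto
  have ls: "l s = height" using nbr_top[OF t b bs] .
  have lb: "l b = 1" using stuck_level[OF t b] .
  obtain par where par: "\<And>v. v \<in> V \<Longrightarrow> v \<noteq> r \<Longrightarrow> E v (par v) \<and> l v = Suc (l (par v))"
    using parent[OF l] by metis
  define w where "w i = (if i \<le> height then (par ^^ i) s else b)" for i
  have w0: "w 0 = s" and wb: "w (Suc height) = b" by (simp_all add: w_def)
  have lev: "w i \<in> V \<and> l (w i) = height - i" if "i \<le> height" for i
    using that
  proof (induction i)
    case 0
    then show ?case using w0 ls bs E_in by auto
  next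
    case (Suc i)
    then have i: "w i \<in> V" "l (w i) = height - i" "0 < height - i" by auto
    then have "w i \<noteq> r" using root_level[OF l] by auto
    moreover have "w (Suc i) = par (w i)" using Suc.prems by (simp add: w_def)
    ultimately show ?case using par[OF i(1)] i E_in by auto
  qed
  have step: "E (w i) (w (Suc i))" if "i < height" for i
  proof -
    have "w i \<noteq> r" using lev[of i] that root_level[OF l] by auto
    moreover have "w (Suc i) = par (w i)" using that by (simp add: w_def)
    ultimately show ?thesis using par lev[of i] that by auto
  qed
  have wr: "w height = r" using level_0[OF l] lev[of height] by auto
  have not_b: "w i \<noteq> b" if i: "i \<le> height" for i
  proof
    assume wi: "w i = b"
    \<comment> \<open>The vertex of level 1 on the descent has a neighbour of level 2, but the
      neighbours \<open>r\<close> and \<open>s\<close> of \<open>b\<close> have levels 0 and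
      \<open>height\<close>.\<close>
    then have i1: "i = height - 1" using lev[OF i] lb i height_ge_5 by auto
    have l2: "l (w (height - 2)) = 2" using lev[of "height - 2"] height_ge_5 by auto
    have "Suc (height - 2) = i" using i1 height_ge_5 by simp
    then have "E (w (height - 2)) b" using step[of "height - 2"] wi height_ge_5 by simp
    then have "w (height - 2) = r \<or> w (height - 2) = s" using nb E_sym by blast
    then show False using l2 ls root_level[OF l] height_ge_5 by auto
  qed
  let ?n = "height + 2"
  have inj: "inj_on w {0..<?n}"
  proof (rule inj_onI)
    fix i j assume ij: "i \<in> {0..<?n}" "j \<in> {0..<?n}" and eq: "w i = w j"
    consider "i \<le> height" "j \<le> height" | "i = Suc height" "j \<le> height"
      | "i \<le> height" "j = Suc height" | "i = Suc height" "j = Suc height"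
      using ij by fastforce
    then show "i = j"
    proof cases
      case 1
      then have "height - i = height - j" using eq lev by metis
      then show ?thesis using 1 by simp
    next
      case 2
      then show ?thesis using not_b eq wb by metis
    next
      case 3
      then show ?thesis using not_b eq wb by metis
    qed simp
  qed
  define nx where "nx i = (if i = Suc height then 0 else Suc i)" for i
  define pv where "pv i = (if i = 0 then Suc height else i - 1)" for i
  have nx: "E (w i) (w (nx i))" if i: "i < ?n" for i
  proof -
    consider "i < height" | "i = height" | "i = Suc height" using i by linarith
    then show ?thesis
    proof cases
      case 1
      then show ?thesis using step by (simp add: nx_def)
    next
      case 2
      then show ?thesis using wr wb E_sym[OF stuck_root[OF t b]] by (simp add: nx_def)
    next
      case 3
      then show ?thesis using wb w0 bs by (simp add: nx_def)
    qed
  qed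
  have pv: "pv i < ?n" "nx (pv i) = i" if "i < ?n" for i
    using that by (auto simp: pv_def nx_def)
  have nx_less: "nx i < ?n" if "i < ?n" for i using that by (auto simp: nx_def)
  have nbrs: "E (w i) v \<longleftrightarrow> v = w (nx i) \<or> v = w (pv i)" if i: "i < ?n" for i v
  proof (rule nbrs_eq)
    show "E (w i) (w (nx i))" using nx[OF i] .
    show "E (w i) (w (pv i))" using E_sym[OF nx[OF pv(1)[OF i]]] pv(2)[OF i] by simp
    have "nx i \<noteq> pv i" using i height_ge_5 by (auto simp: nx_def pv_def)
    then show "w (nx i) \<noteq> w (pv i)"
      using inj_onD[OF inj] nx_less[OF i] pv(1)[OF i] by auto
  qed
  have "w ` {0..<?n} = V"
  proof (rule nbr_closed_eq_V)
    show "w ` {0..<?n} \<subseteq> V" using nx E_in by (metis atLeastLessThan_iff image_subsetI)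
    show "w ` {0..<?n} \<noteq> {}" by simp
    fix u v assume "u \<in> w ` {0..<?n}" "E u v"
    then obtain i where i: "i < ?n" "u = w i" by auto
    then have "v = w (nx i) \<or> v = w (pv i)" using nbrs \<open>E u v\<close> by blast
    then show "v \<in> w ` {0..<?n}" using nx_less[OF i(1)] pv(1)[OF i(1)] by auto
  qed
  then have bij: "bij_betw w {0..<?n} V" using inj unfolding bij_betw_def by blast
  have adj: "E (w i) (w j) \<longleftrightarrow> cycle_graph ?n i j" if ij: "i < ?n" "j < ?n" for i j
  proof -
    have "E (w i) (w j) \<longleftrightarrow> j = nx i \<or> j = pv i"
      using nbrs[OF ij(1)] inj_onD[OF inj] ij nx_less[OF ij(1)] pv(1)[OF ij(1)] by auto
    also have "j = pv i \<longleftrightarrow> i = nx j" using ij by (auto simp: nx_def pv_def)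
    also have "nx i = (i + 1) mod ?n" using ij by (auto simp: nx_def)
    also have "nx j = (j + 1) mod ?n" using ij by (auto simp: nx_def)
    finally have "E (w i) (w j) \<longleftrightarrow> j = (i + 1) mod ?n \<or> i = (j + 1) mod ?n" .
    moreover have "\<not> E (w i) (w j)" if "i = j" using irrefl that by blast
    ultimately show ?thesis using ij unfolding cycle_graph_def by blast
  qed
  have "\<And>i. i \<le> height \<Longrightarrow> l (w i) = height - i" using lev by blast
  then show thesis using that[of l w] bij adj wb lb by simp
qed

section \<open>Excluding longer cycles\<close>

text \<open>Raising the four top levels by one reverses the two arcs leaving that stretch of the
  cycle. From height 8 on, every vertex is then an end of a directed walk with two arcs.\<close>

lemma height_eq_5: "height = 5"
proof (rule ccontr)
  assume "height \<noteq> 5"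
  moreover have "height \<noteq> 6" "height \<noteq> 7" using height_mod by auto
  ultimately have h8: "8 \<le> height" using height_ge_5 by simp
  obtain l w where lev: "\<And>i. i \<le> height \<Longrightarrow> l (w i) = height - i" and lb: "l (w (Suc height)) = 1"
    and bij: "bij_betw w {0..<height + 2} V"
    and adj: "\<And>i j. i < height + 2 \<Longrightarrow> j < height + 2 \<Longrightarrow>
      E (w i) (w j) \<longleftrightarrow> cycle_graph (height + 2) i j"
    using cyclic_enumeration by blast
  have surj: "\<exists>i<height + 2. v = w i" if "v \<in> V" for v
  proof -
    have "v \<in> w ` {0..<height + 2}" using bij that unfolding bij_betw_def by blast
    then show ?thesis by auto
  qed
  define g where "g v = (if height - 3 \<le> l v then Suc (l v) else l v)" for v
  have high: "g (w i) = Suc (height - i)" if "i \<le> 3" for i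
    using that lev[of i] h8 by (simp add: g_def)
  have low: "g (w i) = height - i" if "4 \<le> i" "i \<le> height" for i
    using that lev[of i] h8 by (simp add: g_def)
  have last: "g (w (Suc height)) = 1" using lb h8 by (simp add: g_def)
  have up: "E (w i) (w (Suc i))" if "i \<le> height" for i
    using that adj[of i "Suc i"] by (simp add: cycle_graph_def)
  have close: "E (w (Suc height)) (w 0)" using adj[of "Suc height" 0] by (simp add: cycle_graph_def)
  have next_colour: "g (w i) mod 3 \<noteq> g (w (Suc i)) mod 3" if i: "i \<le> height" for i
  proof -
    consider "i < 3" | "i = 3" | "4 \<le> i" "i < height" | "i = height" using i by linarith
    then show ?thesis
    proof cases
      case 1
      then have "g (w i) = Suc (g (w (Suc i)))" using high[of i] high[of "Suc i"] h8 by simp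
      then show ?thesis by (simp add: mod3_Suc_neq)
    next
      case 2
      then have "g (w i) = Suc (Suc (g (w (Suc i))))" using high[of 3] low[of 4] h8 by simp
      then show ?thesis by (simp add: mod3_Suc2_neq)
    next
      case 3
      then have "g (w i) = Suc (g (w (Suc i)))" using low[of i] low[of "Suc i"] by simp
      then show ?thesis by (simp add: mod3_Suc_neq)
    next
      case 4
      then show ?thesis using low[of height] last h8 by simp
    qed
  qed
  \<comment> \<open>Raising \<open>w 0\<close> changes its residue from 2 to 0, which still differs
    from the colour 1 of the last vertex.\<close>
  have close_colour: "g (w (Suc height)) mod 3 \<noteq> g (w 0) mod 3"
    using last high[of 0] height_mod by (simp add: mod_Suc)
  have "proper3 g"
    unfolding proper3_def
  proof (intro allI impI)
    fix u v assume e: "E u v"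
    obtain i where i: "i < height + 2" "u = w i" using surj E_in[OF e] by blast
    obtain j where j: "j < height + 2" "v = w j" using surj E_in[OF e] by blast
    have "j = (i + 1) mod (height + 2) \<or> i = (j + 1) mod (height + 2)"
      using e i j adj[of i j] unfolding cycle_graph_def by blast
    moreover have "g (w k) mod 3 \<noteq> g (w ((k + 1) mod (height + 2))) mod 3"
      if "k < height + 2" for k
      using that next_colour[of k] close_colour by (cases "k = Suc height") auto
    ultimately show "g u mod 3 \<noteq> g v mod 3" using i j by metis
  qed
  then obtain v where v: "stuck g v" using ex_stuck by blast
  then obtain i where i: "i < height + 2" "v = w i" using surj unfolding stuck_def by blast
  have st: "g z mod 3 = g (w i) mod 3" if "E (w i) y" "E y z" for y z
    using v that i unfolding stuck_def by blast
  show False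
  proof (cases "i = Suc height")
    case True
    have "g (w 1) mod 3 = 1" using st[of "w 0" "w 1"] close up[of 0] last True by simp
    then show False using high[of 1] height_mod h8 by simp
  next
    case False
    \<comment> \<open>The walk descends from \<open>w j\<close> to \<open>w (j + 2)\<close> with
      \<open>w i\<close> at one end. It is read backwards where going forward would cross the
      reversed arc after \<open>w 3\<close> or go past \<open>w height\<close>.\<close>
    define j where "j = (if i = 2 \<or> i = 3 \<or> height - 1 \<le> i then i - 2 else i)"
    have j: "j = i \<or> i = Suc (Suc j)" "j \<le> 1 \<or> 4 \<le> j" "Suc (Suc j) \<le> height"
      using False i(1) h8 by (auto simp: j_def split: if_splits)
    have "g (w (Suc (Suc j))) mod 3 = g (w j) mod 3"
      using j(1)
    proof
      assume "j = i"
      then show ?thesis using st[OF up up] j(3) by simp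
    next
      assume "i = Suc (Suc j)"
      then show ?thesis using st[of "w (Suc j)" "w j"] E_sym[OF up[of j]] E_sym[OF up[of "Suc j"]] j(3)
        by simp
    qed
    moreover have "g (w j) = Suc (Suc (g (w (Suc (Suc j)))))"
      using j(2,3) high[of j] high[of "Suc (Suc j)"] low[of j] low[of "Suc (Suc j)"] by auto
    ultimately show False using mod3_neq_Suc2 by metis
  qed
qed

text \<open>The enumeration runs from indices to vertices, so its inverse is the required
  isomorphism.\<close>

lemma iso_C7: "graph_iso V E {0..<7::nat} (cycle_graph 7)"
proof -
  obtain l w where "\<And>i. i \<le> height \<Longrightarrow> l (w i) = height - i" and "l (w (Suc height)) = 1"
    and "bij_betw w {0..<height + 2} V"
    and "\<And>i j. i < height + 2 \<Longrightarrow> j < height + 2 \<Longrightarrow>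
      E (w i) (w j) \<longleftrightarrow> cycle_graph (height + 2) i j"
    using cyclic_enumeration by blast
  then have bij: "bij_betw w {0..<7} V"
    and adj: "\<And>i j. i < 7 \<Longrightarrow> j < 7 \<Longrightarrow> E (w i) (w j) \<longleftrightarrow> cycle_graph 7 i j"
    by (simp_all add: height_eq_5)
  let ?f = "inv_into {0..<7} w"
  have "E u v \<longleftrightarrow> cycle_graph 7 (?f u) (?f v)" if "u \<in> V" "v \<in> V" for u v
  proof -
    have "?f u < 7" "?f v < 7"
      using bij_betwE[OF bij_betw_inv_into[OF bij]] that by auto
    then show ?thesis
      using adj[of "?f u" "?f v"] bij_betw_inv_into_right[OF bij] that by simp
  qed
  then show ?thesis
    unfolding graph_iso_def using bij_betw_inv_into[OF bij] by blast
qed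

end

section \<open>Return to chromatic numbers and colourful paths\<close>

text \<open>Numbering the vertices is a proper colouring, so the \<open>LEAST\<close> is
  attained.\<close>

lemma chromatic_number_colouring:
  assumes "simple_graph V E"
  shows "\<exists>c. proper_coloring V E (chromatic_number V E) c"
proof -
  have "finite V" using assms unfolding simple_graph_def by blast
  then obtain h where h: "bij_betw h V {1..card V}"
    using ex_bij_betw_nat_finite_1 bij_betw_inv by blast
  have "proper_coloring V E (card V) h"
    using h assms unfolding proper_coloring_def bij_betw_def simple_graph_def inj_on_def by blast
  then show ?thesis
    unfolding chromatic_number_def by (rule LeastI[of "\<lambda>k. \<exists>c. proper_coloring V E k c", OF exI])
qed

theorem theorem2:
  fixes V :: "'a set" and E :: "'a \<Rightarrow> 'a \<Rightarrow> bool"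
  assumes "simple_graph V E"
    and "graph_connected V E"
    and "chromatic_number V E = 3"
    and "\<not> graph_iso V E {0..<7::nat} (cycle_graph 7)"
  shows "\<exists>c. proper_coloring V E 3 c \<and>
           (\<forall>x\<in>V. \<exists>p. colorful_path V E c p \<and> hd p = x)"
proof -
  have E_in: "E u v \<Longrightarrow> u \<in> V \<and> v \<in> V" and E_sym: "E u v \<Longrightarrow> E v u"
    and fin: "finite V" for u v
    using assms(1) unfolding simple_graph_def by blast+
  obtain c0 where c0: "proper_coloring V E 3 c0"
    using chromatic_number_colouring[OF assms(1)] assms(3) by auto
  have range0: "c0 v \<in> {1, 2, 3}" if "v \<in> V" for v
    using c0 that unfolding proper_coloring_def by fastforce
  have colourable: "\<exists>f :: 'a \<Rightarrow> nat. \<forall>u v. E u v \<longrightarrow> f u mod 3 \<noteq> f v mod 3"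
  proof (intro exI[of _ c0] allI impI)
    fix u v assume e: "E u v"
    then have "c0 u \<noteq> c0 v" using c0 E_in unfolding proper_coloring_def by blast
    moreover have "c0 u \<in> {1, 2, 3}" "c0 v \<in> {1, 2, 3}" using range0 E_in[OF e] by blast+
    ultimately show "c0 u mod 3 \<noteq> c0 v mod 3" by auto
  qed
  have not_bipartite: "\<not> (\<exists>h :: 'a \<Rightarrow> bool. \<forall>u v. E u v \<longrightarrow> h u \<noteq> h v)"
  proof
    assume "\<exists>h :: 'a \<Rightarrow> bool. \<forall>u v. E u v \<longrightarrow> h u \<noteq> h v"
    then obtain h :: "'a \<Rightarrow> bool" where h: "\<forall>u v. E u v \<longrightarrow> h u \<noteq> h v" by blast
    have "proper_coloring V E 2 (\<lambda>v. if h v then 1 else 2)"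
      using h unfolding proper_coloring_def by auto
    then have "chromatic_number V E \<le> 2"
      unfolding chromatic_number_def by (intro Least_le) blast
    then show False using assms(3) by simp
  qed
  \<comment> \<open>The negation is precisely the \<open>stubborn\<close> hypothesis of the locale,
    whose conclusion \<open>iso_C7\<close> is excluded.\<close>
  have "\<exists>f. (\<forall>u v. E u v \<longrightarrow> f u mod 3 \<noteq> f v mod 3) \<and>
    \<not> (\<exists>x\<in>V. \<forall>y z. E x y \<longrightarrow> E y z \<longrightarrow> f z mod 3 = (f x :: nat) mod 3)"
  proof (rule ccontr)
    assume bad: "\<not> ?thesis"
    have "stubborn_graph V E"
    proof
      fix f :: "'a \<Rightarrow> nat"
      assume "\<forall>u v. E u v \<longrightarrow> f u mod 3 \<noteq> f v mod 3"
      then show "\<exists>x\<in>V. \<forall>y z. E x y \<longrightarrow> E y z \<longrightarrow> f z mod 3 = f x mod 3"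
        using bad by blast
    qed (use assms(2) E_in E_sym fin colourable not_bipartite in
        \<open>auto simp: graph_connected_def\<close>)
    then show False using stubborn_graph.iso_C7 assms(4) by blast
  qed
  then obtain f :: "'a \<Rightarrow> nat" where f: "\<And>u v. E u v \<Longrightarrow> f u mod 3 \<noteq> f v mod 3"
    and good: "\<And>x. x \<in> V \<Longrightarrow> \<exists>y z. E x y \<and> E y z \<and> f z mod 3 \<noteq> f x mod 3"
    by blast
  \<comment> \<open>Adding one moves the residues 0, 1, 2 into the colour set
    \<open>{1..3}\<close>.\<close>
  define c where "c v = f v mod 3 + 1" for v
  have "c v \<in> {1..3}" for v
    using mod_less_divisor[of 3 "f v"] unfolding c_def by simp
  then have "proper_coloring V E 3 c"
    using f unfolding proper_coloring_def by (auto simp: c_def)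
  moreover have "\<exists>p. colorful_path V E c p \<and> hd p = x" if "x \<in> V" for x
  proof -
    obtain y z where yz: "E x y" "E y z" "f z mod 3 \<noteq> f x mod 3" using good \<open>x \<in> V\<close> by blast
    \<comment> \<open>Adjacent colours differ by properness, the end colours by the choice of
      \<open>z\<close>. Distinct colours also make the three vertices distinct.\<close>
    have d: "distinct (map c [x, y, z])" using f[OF yz(1)] f[OF yz(2)] yz(3) by (auto simp: c_def)
    have "is_path V E [x, y, z]"
      unfolding is_path_def
    proof (intro conjI allI impI)
      show "distinct [x, y, z]" using d by auto
      fix i assume "Suc i < length [x, y, z]"
      then have "i = 0 \<or> i = 1" by auto
      then show "E ([x, y, z] ! i) ([x, y, z] ! Suc i)" using yz by auto
    qed (use yz E_in in auto)
    then have "colorful_path V E c [x, y, z]"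
      using d assms(3) unfolding colorful_path_def by simp
    then show ?thesis by force
  qed
  ultimately show ?thesis by blast
qed

end
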